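(* For every associative ring $R$ with unit, the Lambek torsion theory for right $R$-modules is differential.
   Context: Modules are right modules. A derivation on $R$ is an additive map $\delta:R\to R$ with $\delta(rs)=\delta(r)s+r\delta(s)$ for all $r,s\in R$. Given a derivation $\delta$ on $R$, a $\delta$-derivation on a right $R$-module $M$ is an additive map $d:M\to M$ with $d(xr)=d(x)r+x\delta(r)$ for all $x\in M$, $r\in R$. For $m$ in a right module put $\mathrm{ann}(m)=\{r\in R: mr=0\}$. The Lambek torsion theory is the (hereditary) torsion theory cogenerated by the injective envelope $E(R)$ of the right module $R$, i.e. the largest torsion theory in which $E(R)$ is torsion-free. Its Gabriel filter $\mathfrak{F}$ is the set of all dense right ideals, where a right ideal $I$ is dense if for all $r,s\in R$ with $s\neq0$ there is $t\in R$ with $st\neq0$ and $rt\in I$. The torsion submodule of $M$ is $\mathcal{T}M=\{m\in M:\mathrm{ann}(m)\in\mathfrak{F}\}$. A hereditary torsion theory with Gabriel filter $\mathfrak{F}$ is differential if for every derivation $\delta$ on $R$ and every $I\in\mathfrak{F}$ there is $J\in\mathfrak{F}$ with $\delta(J)\subseteq I$. Equivalently, $d(\mathcal{T}M)\subseteq\mathcal{T}M$ for every right $R$-module $M$, every derivation $\delta$ on $R$ and every $\delta$-derivation $d$ on $M$. *)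

theory Defs
  imports "HOL-Algebra.QuotRing"
begin

section \<open>Right modules\<close>

text \<open>
  The locale of modules in HOL-Algebra is for left modules over commutative rings. As there, a module
  record extends a ring record only in order to reuse \<^locale>\<open>abelian_group\<close>; the fields
  \<^const>\<open>monoid.mult\<close> and \<^const>\<open>one\<close> of a module carry no meaning.
\<close>

record ('a, 'b) rmodule = "'b ring" +
  ract :: "['b, 'a] \<Rightarrow> 'b" (infixl \<open>\<bullet>\<index>\<close> 70)

locale right_module = R?: ring R + M?: abelian_group M
  for R :: "('a, 'm) ring_scheme" (structure) and M :: "('a, 'b, 'n) rmodule_scheme" (structure) +
  assumes ract_closed:
      "\<lbrakk>x \<in> carrier M; r \<in> carrier R\<rbrakk> \<Longrightarrow> x \<bullet>\<^bsub>M\<^esub> r \<in> carrier M"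
    and ract_add_left:
      "\<lbrakk>x \<in> carrier M; y \<in> carrier M; r \<in> carrier R\<rbrakk> \<Longrightarrow>
        (x \<oplus>\<^bsub>M\<^esub> y) \<bullet>\<^bsub>M\<^esub> r = x \<bullet>\<^bsub>M\<^esub> r \<oplus>\<^bsub>M\<^esub> y \<bullet>\<^bsub>M\<^esub> r"
    and ract_add_right:
      "\<lbrakk>x \<in> carrier M; r \<in> carrier R; s \<in> carrier R\<rbrakk> \<Longrightarrow>
        x \<bullet>\<^bsub>M\<^esub> (r \<oplus>\<^bsub>R\<^esub> s) = x \<bullet>\<^bsub>M\<^esub> r \<oplus>\<^bsub>M\<^esub> x \<bullet>\<^bsub>M\<^esub> s"
    and ract_mult:
      "\<lbrakk>x \<in> carrier M; r \<in> carrier R; s \<in> carrier R\<rbrakk> \<Longrightarrow>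
        x \<bullet>\<^bsub>M\<^esub> (r \<otimes>\<^bsub>R\<^esub> s) = (x \<bullet>\<^bsub>M\<^esub> r) \<bullet>\<^bsub>M\<^esub> s"
    and ract_one:
      "x \<in> carrier M \<Longrightarrow> x \<bullet>\<^bsub>M\<^esub> \<one>\<^bsub>R\<^esub> = x"

definition right_submodule ::
  "('a, 'm) ring_scheme \<Rightarrow> 'b set \<Rightarrow> ('a, 'b, 'n) rmodule_scheme \<Rightarrow> bool" where
  "right_submodule R N M \<longleftrightarrow>
     subgroup N (add_monoid M) \<and> (\<forall>x\<in>N. \<forall>r\<in>carrier R. x \<bullet>\<^bsub>M\<^esub> r \<in> N)"

definition rmod_hom ::
  "('a, 'm) ring_scheme \<Rightarrow> ('a, 'b, 'n) rmodule_scheme \<Rightarrow> ('a, 'c, 'p) rmodule_scheme \<Rightarrow> ('b \<Rightarrow> 'c) set"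
  where
  "rmod_hom R M N = {f \<in> carrier M \<rightarrow> carrier N.
     (\<forall>x\<in>carrier M. \<forall>y\<in>carrier M. f (x \<oplus>\<^bsub>M\<^esub> y) = f x \<oplus>\<^bsub>N\<^esub> f y) \<and>
     (\<forall>x\<in>carrier M. \<forall>r\<in>carrier R. f (x \<bullet>\<^bsub>M\<^esub> r) = f x \<bullet>\<^bsub>N\<^esub> r)}"

definition regular_rmodule :: "('a, 'm) ring_scheme \<Rightarrow> ('a, 'a) rmodule" where
  "regular_rmodule R = \<lparr>carrier = carrier R, monoid.mult = monoid.mult R, one = one R,
     zero = zero R, add = add R, ract = monoid.mult R\<rparr>"

definition right_ideal :: "'a set \<Rightarrow> ('a, 'm) ring_scheme \<Rightarrow> bool" where
  "right_ideal I R \<longleftrightarrow> right_submodule R I (regular_rmodule R)"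

text \<open>The action on cosets is set up like \<^const>\<open>rcoset_mult\<close>: \<open>(N + x) r\<close> is \<open>N + x r\<close>.\<close>

definition quotient_rmodule ::
  "('a, 'b, 'n) rmodule_scheme \<Rightarrow> 'b set \<Rightarrow> ('a, 'b set) rmodule" where
  "quotient_rmodule M N = \<lparr>carrier = a_rcosets\<^bsub>M\<^esub> N, monoid.mult = undefined, one = undefined,
     zero = N, add = set_add M, ract = (\<lambda>X r. \<Union>x\<in>X. N +>\<^bsub>M\<^esub> (x \<bullet>\<^bsub>M\<^esub> r))\<rparr>"


section \<open>Injective envelopes\<close>

text \<open>
  HOL cannot quantify over the modules of all types inside a definition, so the extension property is
  required for modules whose elements come from the type of the ring. The regular module and
  its right ideals are among these, hence by Baer's criterion nothing is lost.
\<close>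

definition injective_rmodule :: "('a, 'm) ring_scheme \<Rightarrow> ('a, 'e, 'n) rmodule_scheme \<Rightarrow> bool" where
  "injective_rmodule R E \<longleftrightarrow> right_module R E \<and>
     (\<forall>(M :: ('a, 'a) rmodule) N. right_module R M \<and> right_submodule R N M \<longrightarrow>
        (\<forall>f\<in>rmod_hom R (M\<lparr>carrier := N\<rparr>) E. \<exists>g\<in>rmod_hom R M E. \<forall>x\<in>N. g x = f x))"

definition essential_rsubmodule ::
  "('a, 'm) ring_scheme \<Rightarrow> 'b set \<Rightarrow> ('a, 'b, 'n) rmodule_scheme \<Rightarrow> bool" where
  "essential_rsubmodule R K M \<longleftrightarrow> right_submodule R K M \<and>
     (\<forall>N. right_submodule R N M \<and> N \<inter> K = {\<zero>\<^bsub>M\<^esub>} \<longrightarrow> N = {\<zero>\<^bsub>M\<^esub>})"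

definition injective_envelope ::
  "('a, 'm) ring_scheme \<Rightarrow> ('a, 'b, 'n) rmodule_scheme \<Rightarrow> ('a, 'e, 'p) rmodule_scheme \<Rightarrow> ('b \<Rightarrow> 'e) \<Rightarrow> bool"
  where
  "injective_envelope R M E \<iota> \<longleftrightarrow> injective_rmodule R E \<and> \<iota> \<in> rmod_hom R M E \<and>
     inj_on \<iota> (carrier M) \<and> essential_rsubmodule R (\<iota> ` carrier M) E"


section \<open>Torsion theories, Gabriel filters and derivations\<close>

text \<open>
  A torsion theory is represented by its class of torsion modules. The theory cogenerated by
  \<open>E\<close>, which is the largest one in which \<open>E\<close> is torsion-free, has the modules \<open>M\<close> with
  \<open>Hom(M, E) = 0\<close> as its torsion modules.
\<close>

definition cogenerated_torsion ::
  "('a, 'm) ring_scheme \<Rightarrow> ('a, 'e, 'n) rmodule_scheme \<Rightarrow> ('a, 'b, 'p) rmodule_scheme \<Rightarrow> bool" where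
  "cogenerated_torsion R E M \<longleftrightarrow> right_module R M \<and>
     (\<forall>f\<in>rmod_hom R M E. \<forall>x\<in>carrier M. f x = \<zero>\<^bsub>E\<^esub>)"

definition gabriel_filter ::
  "('a, 'm) ring_scheme \<Rightarrow> (('a, 'a set) rmodule \<Rightarrow> bool) \<Rightarrow> 'a set set" where
  "gabriel_filter R tors = {I. right_ideal I R \<and> tors (quotient_rmodule (regular_rmodule R) I)}"

definition dense_right_ideal :: "'a set \<Rightarrow> ('a, 'm) ring_scheme \<Rightarrow> bool" where
  "dense_right_ideal I R \<longleftrightarrow> right_ideal I R \<and>
     (\<forall>r\<in>carrier R. \<forall>s\<in>carrier R. s \<noteq> \<zero>\<^bsub>R\<^esub> \<longrightarrow>
        (\<exists>t\<in>carrier R. s \<otimes>\<^bsub>R\<^esub> t \<noteq> \<zero>\<^bsub>R\<^esub> \<and> r \<otimes>\<^bsub>R\<^esub> t \<in> I))"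

definition ring_derivation :: "('a, 'm) ring_scheme \<Rightarrow> ('a \<Rightarrow> 'a) \<Rightarrow> bool" where
  "ring_derivation R \<delta> \<longleftrightarrow> \<delta> \<in> carrier R \<rightarrow> carrier R \<and>
     (\<forall>r\<in>carrier R. \<forall>s\<in>carrier R.
        \<delta> (r \<oplus>\<^bsub>R\<^esub> s) = \<delta> r \<oplus>\<^bsub>R\<^esub> \<delta> s \<and>
        \<delta> (r \<otimes>\<^bsub>R\<^esub> s) = \<delta> r \<otimes>\<^bsub>R\<^esub> s \<oplus>\<^bsub>R\<^esub> r \<otimes>\<^bsub>R\<^esub> \<delta> s)"

text \<open>The torsion theory with Gabriel filter \<open>F\<close> is differential.\<close>

definition differential_filter :: "('a, 'm) ring_scheme \<Rightarrow> 'a set set \<Rightarrow> bool" where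
  "differential_filter R F \<longleftrightarrow>
     (\<forall>\<delta>. ring_derivation R \<delta> \<longrightarrow> (\<forall>I\<in>F. \<exists>J\<in>F. \<delta> ` J \<subseteq> I))"

end

theory Submission
  imports Defs
begin

text \<open>
  Let \<open>\<delta>\<close> be a derivation and \<open>I\<close> a dense right ideal. The right ideal
  \<open>J = {r \<in> I. \<delta> r \<in> I}\<close> satisfies \<open>\<delta>(J) \<subseteq> I\<close>, and the point is that it is again dense
  (\<open>derivation_dense_preimage\<close>). Given \<open>r\<close> and \<open>s \<noteq> 0\<close>, density of \<open>I\<close> is used
  twice: first to find \<open>t\<close> with \<open>r t \<in> I\<close> and \<open>s t \<noteq> 0\<close>, and then, for the pair
  \<open>\<delta>(r t)\<close>, \<open>s t\<close>, to find \<open>u\<close> with \<open>\<delta>(r t) u \<in> I\<close> and \<open>s t u \<noteq> 0\<close>. In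
  \<open>\<delta>(r t u) = \<delta>(r t) u + r t \<delta>(u)\<close> the first summand is in \<open>I\<close> by the choice of \<open>u\<close>,
  and the second one because \<open>r t \<in> I\<close> and \<open>I\<close> is a right ideal.

  The statement about the torsion theory cogenerated by an injective envelope \<open>E\<close> of \<open>R\<close>
  follows since its Gabriel filter consists of the dense right ideals
  (\<open>gabriel_filter_cogenerated_by_envelope\<close>). If \<open>r\<close>, \<open>s\<close> witness that \<open>I\<close> is not dense,
  then \<open>r t + i \<mapsto> s t\<close> is a well-defined map from \<open>r R + I\<close> to \<open>R\<close>; injectivity of
  \<open>E\<close> extends it to \<open>R\<close>, and the extension kills \<open>I\<close> but not \<open>r\<close>, so \<open>R/I\<close> has a
  nonzero map to \<open>E\<close>. Conversely, a nonzero value \<open>e\<close> of a map \<open>R/I \<rightarrow> E\<close> has, as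
  \<open>R\<close> is essential in \<open>E\<close>, a nonzero multiple in \<open>R\<close>. Density of \<open>I\<close> yields a further
  multiple that is still nonzero, although it is the image of the zero coset.
\<close>

section \<open>Submodules and homomorphisms of right modules\<close>

lemma rmod_hom_closed: "\<lbrakk>f \<in> rmod_hom R M N; x \<in> carrier M\<rbrakk> \<Longrightarrow> f x \<in> carrier N"
  by (auto simp: rmod_hom_def)

lemma rmod_hom_add:
  "\<lbrakk>f \<in> rmod_hom R M N; x \<in> carrier M; y \<in> carrier M\<rbrakk> \<Longrightarrow> f (x \<oplus>\<^bsub>M\<^esub> y) = f x \<oplus>\<^bsub>N\<^esub> f y"
  by (auto simp: rmod_hom_def)

lemma rmod_hom_ract:
  "\<lbrakk>f \<in> rmod_hom R M N; x \<in> carrier M; r \<in> carrier R\<rbrakk> \<Longrightarrow> f (x \<bullet>\<^bsub>M\<^esub> r) = f x \<bullet>\<^bsub>N\<^esub> r"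
  by (auto simp: rmod_hom_def)

lemma rmod_hom_abelian_group_hom:
  assumes "abelian_group M" "abelian_group N" "f \<in> rmod_hom R M N"
  shows "abelian_group_hom M N f"
proof -
  interpret M: abelian_group M by fact
  interpret N: abelian_group N by fact
  show ?thesis
    using assms(3)
    by (intro abelian_group_homI assms group_hom.intro M.a_group N.a_group group_hom_axioms.intro)
      (auto simp: rmod_hom_def hom_def)
qed

context right_module
begin

lemma submodule_abelian_subgroup:
  assumes "right_submodule R N M"
  shows "abelian_subgroup N M"
  using assms M.abelian_group_axioms
  by (auto simp: right_submodule_def intro: abelian_subgroupI3 additive_subgroupI)

lemma submodule_ract_closed:
  "\<lbrakk>right_submodule R N M; x \<in> N; r \<in> carrier R\<rbrakk> \<Longrightarrow> x \<bullet>\<^bsub>M\<^esub> r \<in> N"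
  by (auto simp: right_submodule_def)

lemma ract_zero_right:
  assumes "x \<in> carrier M"
  shows "x \<bullet>\<^bsub>M\<^esub> \<zero> = \<zero>\<^bsub>M\<^esub>"
proof -
  have "x \<bullet>\<^bsub>M\<^esub> \<zero> \<oplus>\<^bsub>M\<^esub> x \<bullet>\<^bsub>M\<^esub> \<zero> = x \<bullet>\<^bsub>M\<^esub> \<zero>"
    using ract_add_right[OF assms, of \<zero> \<zero>] by simp
  then show ?thesis
    using assms ract_closed M.add.l_cancel_one by blast
qed

lemma ract_zero_left:
  assumes "r \<in> carrier R"
  shows "\<zero>\<^bsub>M\<^esub> \<bullet>\<^bsub>M\<^esub> r = \<zero>\<^bsub>M\<^esub>"
proof -
  have "\<zero>\<^bsub>M\<^esub> \<bullet>\<^bsub>M\<^esub> r \<oplus>\<^bsub>M\<^esub> \<zero>\<^bsub>M\<^esub> \<bullet>\<^bsub>M\<^esub> r = \<zero>\<^bsub>M\<^esub> \<bullet>\<^bsub>M\<^esub> r"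
    using ract_add_left[of "\<zero>\<^bsub>M\<^esub>" "\<zero>\<^bsub>M\<^esub>" r] assms by simp
  then show ?thesis
    using assms ract_closed M.add.l_cancel_one by blast
qed

lemma ract_minus_right:
  assumes "x \<in> carrier M" "r \<in> carrier R"
  shows "x \<bullet>\<^bsub>M\<^esub> (\<ominus> r) = \<ominus>\<^bsub>M\<^esub> (x \<bullet>\<^bsub>M\<^esub> r)"
proof (rule M.minus_equality[symmetric])
  show "x \<bullet>\<^bsub>M\<^esub> (\<ominus> r) \<oplus>\<^bsub>M\<^esub> x \<bullet>\<^bsub>M\<^esub> r = \<zero>\<^bsub>M\<^esub>"
    using ract_add_right[of x "\<ominus> r" r] assms by (simp add: R.l_neg ract_zero_right)
qed (use assms in \<open>auto simp: ract_closed\<close>)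

lemma ract_minus_left:
  assumes "x \<in> carrier M" "r \<in> carrier R"
  shows "(\<ominus>\<^bsub>M\<^esub> x) \<bullet>\<^bsub>M\<^esub> r = \<ominus>\<^bsub>M\<^esub> (x \<bullet>\<^bsub>M\<^esub> r)"
proof (rule M.minus_equality[symmetric])
  show "(\<ominus>\<^bsub>M\<^esub> x) \<bullet>\<^bsub>M\<^esub> r \<oplus>\<^bsub>M\<^esub> x \<bullet>\<^bsub>M\<^esub> r = \<zero>\<^bsub>M\<^esub>"
    using ract_add_left[of "\<ominus>\<^bsub>M\<^esub> x" x r] assms by (simp add: M.l_neg ract_zero_left)
qed (use assms in \<open>auto simp: ract_closed\<close>)

text \<open>Closure under negation comes for free, since \<open>- x = x (- 1)\<close>.\<close>

lemma submoduleI: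
  assumes "N \<subseteq> carrier M" "N \<noteq> {}"
    and add: "\<And>x y. \<lbrakk>x \<in> N; y \<in> N\<rbrakk> \<Longrightarrow> x \<oplus>\<^bsub>M\<^esub> y \<in> N"
    and ract: "\<And>x r. \<lbrakk>x \<in> N; r \<in> carrier R\<rbrakk> \<Longrightarrow> x \<bullet>\<^bsub>M\<^esub> r \<in> N"
  shows "right_submodule R N M"
  unfolding right_submodule_def
proof (intro conjI ballI ract)
  show "subgroup N (add_monoid M)"
  proof (rule M.add.subgroupI)
    fix x assume "x \<in> N"
    moreover have "x \<bullet>\<^bsub>M\<^esub> (\<ominus> \<one>) = \<ominus>\<^bsub>M\<^esub> x"
      using \<open>x \<in> N\<close> assms(1) ract_minus_right[of x \<one>] ract_one[of x] by auto
    ultimately show "\<ominus>\<^bsub>M\<^esub> x \<in> N"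
      using ract[of x "\<ominus> \<one>"] by simp
  qed (use assms in auto)
qed

lemma cyclic_submodule:
  assumes "x \<in> carrier M"
  shows "right_submodule R {x \<bullet>\<^bsub>M\<^esub> r | r. r \<in> carrier R} M"
proof (rule submoduleI)
  show "{x \<bullet>\<^bsub>M\<^esub> r | r. r \<in> carrier R} \<noteq> {}"
    using R.one_closed by blast
next
  fix y z assume "y \<in> {x \<bullet>\<^bsub>M\<^esub> r | r. r \<in> carrier R}" "z \<in> {x \<bullet>\<^bsub>M\<^esub> r | r. r \<in> carrier R}"
  then obtain r s where "r \<in> carrier R" "s \<in> carrier R" "y = x \<bullet>\<^bsub>M\<^esub> r" "z = x \<bullet>\<^bsub>M\<^esub> s"
    by blast
  then have "r \<oplus> s \<in> carrier R" "y \<oplus>\<^bsub>M\<^esub> z = x \<bullet>\<^bsub>M\<^esub> (r \<oplus> s)"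
    using ract_add_right[OF assms] by simp_all
  then show "y \<oplus>\<^bsub>M\<^esub> z \<in> {x \<bullet>\<^bsub>M\<^esub> r | r. r \<in> carrier R}"
    by blast
next
  fix y r assume "y \<in> {x \<bullet>\<^bsub>M\<^esub> r | r. r \<in> carrier R}" and r: "r \<in> carrier R"
  then obtain s where "s \<in> carrier R" "y = x \<bullet>\<^bsub>M\<^esub> s"
    by blast
  then have "s \<otimes> r \<in> carrier R" "y \<bullet>\<^bsub>M\<^esub> r = x \<bullet>\<^bsub>M\<^esub> (s \<otimes> r)"
    using ract_mult[OF assms _ r] r by simp_all
  then show "y \<bullet>\<^bsub>M\<^esub> r \<in> {x \<bullet>\<^bsub>M\<^esub> r | r. r \<in> carrier R}"
    by blast
qed (use assms ract_closed in auto)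

end


section \<open>Quotient modules\<close>

lemma quotient_rmodule_simps [simp]:
  "carrier (quotient_rmodule M N) = a_rcosets\<^bsub>M\<^esub> N"
  "zero (quotient_rmodule M N) = N"
  "add (quotient_rmodule M N) = set_add M"
  "X \<bullet>\<^bsub>quotient_rmodule M N\<^esub> r = (\<Union>x\<in>X. N +>\<^bsub>M\<^esub> (x \<bullet>\<^bsub>M\<^esub> r))"
  by (simp_all add: quotient_rmodule_def)

context right_module
begin

lemma quotient_rmodule_carrierE:
  assumes "X \<in> carrier (quotient_rmodule M N)"
  obtains x where "x \<in> carrier M" "X = N +>\<^bsub>M\<^esub> x"
  using assms by (auto simp: A_RCOSETS_def')

text \<open>
  All summands of the union defining the action agree, because \<open>y - x \<in> N\<close> implies
  \<open>y r - x r = (y - x) r \<in> N\<close>.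
\<close>

lemma quotient_ract_coset:
  assumes N: "right_submodule R N M" and x: "x \<in> carrier M" and r: "r \<in> carrier R"
  shows "(N +>\<^bsub>M\<^esub> x) \<bullet>\<^bsub>quotient_rmodule M N\<^esub> r = N +>\<^bsub>M\<^esub> (x \<bullet>\<^bsub>M\<^esub> r)"
proof -
  interpret N: abelian_subgroup N M
    by (rule submodule_abelian_subgroup[OF N])
  have coset_eq: "N +>\<^bsub>M\<^esub> (y \<bullet>\<^bsub>M\<^esub> r) = N +>\<^bsub>M\<^esub> (x \<bullet>\<^bsub>M\<^esub> r)" if y: "y \<in> N +>\<^bsub>M\<^esub> x" for y
  proof -
    have yc: "y \<in> carrier M"
      using N.a_elemrcos_carrier[OF x y] .
    have "(y \<oplus>\<^bsub>M\<^esub> \<ominus>\<^bsub>M\<^esub> x) \<bullet>\<^bsub>M\<^esub> r \<in> N"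
      by (intro submodule_ract_closed[OF N] N.a_rcos_module_imp x y r)
    then have "y \<bullet>\<^bsub>M\<^esub> r \<oplus>\<^bsub>M\<^esub> \<ominus>\<^bsub>M\<^esub> (x \<bullet>\<^bsub>M\<^esub> r) \<in> N"
      using x yc r by (simp add: ract_add_left ract_minus_left)
    then show ?thesis
      using x yc r by (metis N.a_rcos_module_rev N.a_repr_independence' ract_closed)
  qed
  have "(\<Union>y\<in>N +>\<^bsub>M\<^esub> x. N +>\<^bsub>M\<^esub> (y \<bullet>\<^bsub>M\<^esub> r)) = N +>\<^bsub>M\<^esub> (x \<bullet>\<^bsub>M\<^esub> r)"
    by (rule UN_constant_eq[OF N.a_rcos_self[OF x] ballI[OF coset_eq]])
  then show ?thesis
    by (simp only: quotient_rmodule_simps)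
qed

lemma right_module_quotient:
  assumes N: "right_submodule R N M"
  shows "right_module R (quotient_rmodule M N)"
proof -
  interpret N: abelian_subgroup N M
    by (rule submodule_abelian_subgroup[OF N])
  let ?Q = "quotient_rmodule M N"
  have coset: "N +>\<^bsub>M\<^esub> x \<in> a_rcosets\<^bsub>M\<^esub> N" if "x \<in> carrier M" for x
    by (rule M.a_rcosetsI[OF N.a_subset that])
  note ract = quotient_ract_coset[OF N, simplified]
  have "abelian_group ?Q"
  proof (rule abelian_groupI)
    fix X Y assume "X \<in> carrier ?Q" "Y \<in> carrier ?Q"
    then show "X \<oplus>\<^bsub>?Q\<^esub> Y = Y \<oplus>\<^bsub>?Q\<^esub> X"
      by (elim quotient_rmodule_carrierE) (simp add: N.a_rcos_sum M.a_comm)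
  next
    fix X assume "X \<in> carrier ?Q"
    then show "\<exists>Y\<in>carrier ?Q. Y \<oplus>\<^bsub>?Q\<^esub> X = \<zero>\<^bsub>?Q\<^esub>"
      using N.a_setinv_closed N.a_rcosets_inv_mult_group_eq by auto
  qed (auto simp: N.a_setmult_closed N.a_rcosets_assoc N.a_subgroup_in_rcosets N.rcosets_add_eq)
  then show ?thesis
  proof (intro right_module.intro right_module_axioms.intro R.ring_axioms)
    fix X r assume "X \<in> carrier ?Q" "r \<in> carrier R"
    then show "X \<bullet>\<^bsub>?Q\<^esub> r \<in> carrier ?Q"
      by (elim quotient_rmodule_carrierE) (simp add: ract ract_closed coset)
  next
    fix X Y r assume "X \<in> carrier ?Q" "Y \<in> carrier ?Q" "r \<in> carrier R"
    then show "(X \<oplus>\<^bsub>?Q\<^esub> Y) \<bullet>\<^bsub>?Q\<^esub> r = X \<bullet>\<^bsub>?Q\<^esub> r \<oplus>\<^bsub>?Q\<^esub> Y \<bullet>\<^bsub>?Q\<^esub> r"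
      by (elim quotient_rmodule_carrierE)
        (simp add: ract ract_closed ract_add_left N.a_rcos_sum)
  next
    fix X r s assume "X \<in> carrier ?Q" "r \<in> carrier R" "s \<in> carrier R"
    then show "X \<bullet>\<^bsub>?Q\<^esub> (r \<oplus> s) = X \<bullet>\<^bsub>?Q\<^esub> r \<oplus>\<^bsub>?Q\<^esub> X \<bullet>\<^bsub>?Q\<^esub> s"
      by (elim quotient_rmodule_carrierE)
        (simp add: ract ract_closed ract_add_right N.a_rcos_sum)
  next
    fix X r s assume "X \<in> carrier ?Q" "r \<in> carrier R" "s \<in> carrier R"
    then show "X \<bullet>\<^bsub>?Q\<^esub> (r \<otimes> s) = (X \<bullet>\<^bsub>?Q\<^esub> r) \<bullet>\<^bsub>?Q\<^esub> s"
      by (elim quotient_rmodule_carrierE) (simp add: ract ract_closed ract_mult)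
  next
    fix X assume "X \<in> carrier ?Q"
    then show "X \<bullet>\<^bsub>?Q\<^esub> \<one> = X"
      by (elim quotient_rmodule_carrierE) (simp add: ract ract_one)
  qed
qed

lemma rmod_hom_factors_through_quotient:
  assumes N: "right_submodule R N M" and E: "abelian_group E"
    and g: "g \<in> rmod_hom R M E" and zero: "\<And>x. x \<in> N \<Longrightarrow> g x = \<zero>\<^bsub>E\<^esub>"
  obtains h where "h \<in> rmod_hom R (quotient_rmodule M N) E"
    "\<And>x. x \<in> carrier M \<Longrightarrow> h (N +>\<^bsub>M\<^esub> x) = g x"
proof -
  interpret N: abelian_subgroup N M
    by (rule submodule_abelian_subgroup[OF N])
  interpret E: abelian_group E by fact
  define h where "h X = the_elem (g ` X)" for X
  have h_coset: "h (N +>\<^bsub>M\<^esub> x) = g x" if x: "x \<in> carrier M" for x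
  proof -
    have "g (n \<oplus>\<^bsub>M\<^esub> x) = g x" if "n \<in> N" for n
      using rmod_hom_add[OF g N.a_Hcarr[OF that] x] zero[OF that]
        E.l_zero[OF rmod_hom_closed[OF g x]] by metis
    then have "g y = g x" if "y \<in> N +>\<^bsub>M\<^esub> x" for y
      using that unfolding a_r_coset_def' by blast
    then have "g ` (N +>\<^bsub>M\<^esub> x) = {g x}"
      using N.a_rcos_self[OF x] by blast
    then show ?thesis
      by (simp add: h_def)
  qed
  have "h \<in> rmod_hom R (quotient_rmodule M N) E"
    unfolding rmod_hom_def
  proof (intro CollectI conjI ballI funcsetI)
    fix X assume "X \<in> carrier (quotient_rmodule M N)"
    then show "h X \<in> carrier E"
      by (elim quotient_rmodule_carrierE) (simp add: h_coset rmod_hom_closed[OF g])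
  next
    fix X Y assume "X \<in> carrier (quotient_rmodule M N)" "Y \<in> carrier (quotient_rmodule M N)"
    then show "h (X \<oplus>\<^bsub>quotient_rmodule M N\<^esub> Y) = h X \<oplus>\<^bsub>E\<^esub> h Y"
      by (elim quotient_rmodule_carrierE) (simp add: N.a_rcos_sum h_coset rmod_hom_add[OF g])
  next
    fix X r assume "X \<in> carrier (quotient_rmodule M N)" "r \<in> carrier R"
    then show "h (X \<bullet>\<^bsub>quotient_rmodule M N\<^esub> r) = h X \<bullet>\<^bsub>E\<^esub> r"
      by (elim quotient_rmodule_carrierE)
        (simp add: quotient_ract_coset[OF N, simplified] h_coset ract_closed rmod_hom_ract[OF g])
  qed
  then show ?thesis
    using that h_coset by blast
qed

end


section \<open>Dense right ideals and the injective envelope\<close>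

lemma regular_rmodule_simps [simp]:
  "carrier (regular_rmodule R) = carrier R"
  "zero (regular_rmodule R) = zero R"
  "add (regular_rmodule R) = add R"
  "ract (regular_rmodule R) = monoid.mult R"
  by (simp_all add: regular_rmodule_def)

context ring
begin

lemma right_module_regular: "right_module R (regular_rmodule R)"
proof -
  have "abelian_group (regular_rmodule R)"
    by (rule abelian_groupI) (auto simp: a_ac intro: add.l_inv_ex)
  then show ?thesis
    by (intro right_module.intro right_module_axioms.intro ring_axioms)
      (auto simp: l_distr r_distr m_assoc)
qed

lemma regular_a_inv [simp]: "a_inv (regular_rmodule R) = a_inv R"
  by (simp add: a_inv_def m_inv_def fun_eq_iff)

lemma right_idealI:
  assumes "I \<subseteq> carrier R" "I \<noteq> {}"
    and "\<And>x y. \<lbrakk>x \<in> I; y \<in> I\<rbrakk> \<Longrightarrow> x \<oplus> y \<in> I"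
    and "\<And>x r. \<lbrakk>x \<in> I; r \<in> carrier R\<rbrakk> \<Longrightarrow> x \<otimes> r \<in> I"
  shows "right_ideal I R"
  using right_module.submoduleI[OF right_module_regular, of I] assms
  by (simp add: right_ideal_def)

lemma right_ideal_closed:
  assumes I: "right_ideal I R"
  shows "I \<subseteq> carrier R" and "\<zero> \<in> I"
    and "\<And>x y. \<lbrakk>x \<in> I; y \<in> I\<rbrakk> \<Longrightarrow> x \<oplus> y \<in> I"
    and "\<And>x. x \<in> I \<Longrightarrow> \<ominus> x \<in> I"
    and "\<And>x r. \<lbrakk>x \<in> I; r \<in> carrier R\<rbrakk> \<Longrightarrow> x \<otimes> r \<in> I"
proof -
  have "additive_subgroup I (regular_rmodule R)"
    using I by (simp add: right_ideal_def right_submodule_def additive_subgroup.intro)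
  note sub = additive_subgroup.a_subset[OF this] additive_subgroup.zero_closed[OF this]
    additive_subgroup.a_closed[OF this] additive_subgroup.a_inv_closed[OF this]
  show "I \<subseteq> carrier R" and "\<zero> \<in> I"
    and "\<And>x y. \<lbrakk>x \<in> I; y \<in> I\<rbrakk> \<Longrightarrow> x \<oplus> y \<in> I"
    and "\<And>x. x \<in> I \<Longrightarrow> \<ominus> x \<in> I"
    using sub by simp_all
  show "\<And>x r. \<lbrakk>x \<in> I; r \<in> carrier R\<rbrakk> \<Longrightarrow> x \<otimes> r \<in> I"
    using I by (simp add: right_ideal_def right_submodule_def)
qed

text \<open>
  Elements \<open>r\<close> and \<open>s \<noteq> 0\<close> that violate density are such that \<open>r t \<in> I\<close> always forces
  \<open>s t = 0\<close>. So the coset of \<open>r\<close> can be sent to \<open>s\<close> by a homomorphism from the cyclic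
  submodule of \<open>R/I\<close> that it generates. The extension to \<open>E\<close> is made before passing to the
  quotient, on the preimage \<open>r R + I\<close> of that submodule: injectivity as defined speaks of modules
  over the element type of the ring, and the elements of \<open>R/I\<close> are sets.
\<close>

lemma dense_if_torsion:
  fixes E :: "('a, 'e, 'n) rmodule_scheme"
  assumes env: "injective_envelope R (regular_rmodule R) E \<iota>"
    and I: "right_ideal I R"
    and tors: "cogenerated_torsion R E (quotient_rmodule (regular_rmodule R) I)"
  shows "dense_right_ideal I R"
proof (rule ccontr)
  let ?A = "regular_rmodule R"
  interpret A: right_module R ?A by (rule right_module_regular)
  interpret E: right_module R E
    using env by (simp add: injective_envelope_def injective_rmodule_def)
  have \<iota>: "\<iota> \<in> rmod_hom R ?A E" and inj: "inj_on \<iota> (carrier R)"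
    using env by (simp_all add: injective_envelope_def)
  interpret \<iota>: abelian_group_hom ?A E \<iota>
    by (rule rmod_hom_abelian_group_hom[OF A.M.abelian_group_axioms E.M.abelian_group_axioms \<iota>])
  note I_closed = right_ideal_closed[OF I]
  have Ic: "x \<in> carrier R" if "x \<in> I" for x
    using that I_closed(1) by auto
  assume "\<not> dense_right_ideal I R"
  then obtain r s where r: "r \<in> carrier R" and s: "s \<in> carrier R" and "s \<noteq> \<zero>"
    and ann: "\<And>t. \<lbrakk>t \<in> carrier R; r \<otimes> t \<in> I\<rbrakk> \<Longrightarrow> s \<otimes> t = \<zero>"
    using I unfolding dense_right_ideal_def by blast
  \<comment> \<open>\<open>coeff y\<close> chooses one of the possible \<open>t\<close>; by \<open>s_eq\<close> below, the product with \<open>s\<close>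
      does not depend on the choice.\<close>
  define N where "N = {r \<otimes> t \<oplus> i | t i. t \<in> carrier R \<and> i \<in> I}"
  define coeff where "coeff y = (SOME t. t \<in> carrier R \<and> (\<exists>i\<in>I. y = r \<otimes> t \<oplus> i))" for y
  define f where "f y = \<iota> (s \<otimes> coeff y)" for y
  have s_eq: "s \<otimes> t = s \<otimes> t'"
    if t: "t \<in> carrier R" "t' \<in> carrier R" and i: "i \<in> I" "i' \<in> I"
      and eq: "r \<otimes> t \<oplus> i = r \<otimes> t' \<oplus> i'" for t t' i i'
  proof -
    have "r \<otimes> (t \<ominus> t') = i' \<ominus> i"
    proof -
      have "r \<otimes> (t \<ominus> t') = (r \<otimes> t \<oplus> i) \<ominus> (r \<otimes> t' \<oplus> i)"
        using r t i Ic by algebra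
      also have "\<dots> = i' \<ominus> i"
        unfolding eq using r t i Ic by algebra
      finally show ?thesis .
    qed
    then have "s \<otimes> (t \<ominus> t') = \<zero>"
      using t i by (intro ann) (simp_all add: minus_eq I_closed)
    moreover have "s \<otimes> t = s \<otimes> (t \<ominus> t') \<oplus> s \<otimes> t'"
      using s t by algebra
    ultimately show ?thesis
      using s t by simp
  qed
  have f_eq: "f (r \<otimes> t \<oplus> i) = \<iota> (s \<otimes> t)" if t: "t \<in> carrier R" and i: "i \<in> I" for t i
  proof -
    have "coeff (r \<otimes> t \<oplus> i) \<in> carrier R \<and> (\<exists>j\<in>I. r \<otimes> t \<oplus> i = r \<otimes> coeff (r \<otimes> t \<oplus> i) \<oplus> j)"
      unfolding coeff_def by (rule someI[where x = t]) (use t i in blast)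
    then show ?thesis
      using s_eq t i unfolding f_def by metis
  qed
  have N_add: "(r \<otimes> t \<oplus> i) \<oplus> (r \<otimes> t' \<oplus> i') = r \<otimes> (t \<oplus> t') \<oplus> (i \<oplus> i')"
    if "t \<in> carrier R" "t' \<in> carrier R" "i \<in> I" "i' \<in> I" for t t' i i'
    using that r Ic by algebra
  have N_mult: "(r \<otimes> t \<oplus> i) \<otimes> u = r \<otimes> (t \<otimes> u) \<oplus> i \<otimes> u"
    if "t \<in> carrier R" "i \<in> I" "u \<in> carrier R" for t i u
    using that r Ic by algebra
  have N: "right_submodule R N ?A"
  proof (rule A.submoduleI)
    show "N \<subseteq> carrier ?A"
      using r Ic by (auto simp: N_def)
    show "N \<noteq> {}"
      using I_closed(2) by (auto simp: N_def)
    show "x \<oplus>\<^bsub>?A\<^esub> y \<in> N" if "x \<in> N" "y \<in> N" for x y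
      using that N_add I_closed(3) unfolding N_def by simp (metis add.m_closed)
    show "x \<bullet>\<^bsub>?A\<^esub> u \<in> N" if "x \<in> N" "u \<in> carrier R" for x u
      using that N_mult I_closed(5) unfolding N_def by simp (metis m_closed)
  qed
  have "f \<in> rmod_hom R (?A\<lparr>carrier := N\<rparr>) E"
    unfolding rmod_hom_def
  proof (intro CollectI conjI ballI funcsetI)
    fix x assume "x \<in> carrier (?A\<lparr>carrier := N\<rparr>)"
    then show "f x \<in> carrier E"
      using rmod_hom_closed[OF \<iota>] s by (auto simp: N_def f_eq)
  next
    fix x y assume "x \<in> carrier (?A\<lparr>carrier := N\<rparr>)" "y \<in> carrier (?A\<lparr>carrier := N\<rparr>)"
    then obtain t i t' i' where ti: "t \<in> carrier R" "i \<in> I" "t' \<in> carrier R" "i' \<in> I"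
      and xy: "x = r \<otimes> t \<oplus> i" "y = r \<otimes> t' \<oplus> i'"
      by (auto simp: N_def)
    have "f (x \<oplus> y) = \<iota> (s \<otimes> (t \<oplus> t'))"
      using ti by (simp add: xy N_add f_eq I_closed)
    also have "\<dots> = f x \<oplus>\<^bsub>E\<^esub> f y"
      using ti s rmod_hom_add[OF \<iota>, of "s \<otimes> t" "s \<otimes> t'"] by (simp add: xy f_eq r_distr)
    finally show "f (x \<oplus>\<^bsub>?A\<lparr>carrier := N\<rparr>\<^esub> y) = f x \<oplus>\<^bsub>E\<^esub> f y"
      by simp
  next
    fix x u assume "x \<in> carrier (?A\<lparr>carrier := N\<rparr>)" and u: "u \<in> carrier R"
    then obtain t i where ti: "t \<in> carrier R" "i \<in> I" and x: "x = r \<otimes> t \<oplus> i"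
      by (auto simp: N_def)
    have "f (x \<otimes> u) = \<iota> (s \<otimes> (t \<otimes> u))"
      using ti u by (simp add: x N_mult f_eq I_closed)
    also have "\<dots> = f x \<bullet>\<^bsub>E\<^esub> u"
      using ti u s rmod_hom_ract[OF \<iota>, of "s \<otimes> t" u] by (simp add: x f_eq m_assoc)
    finally show "f (x \<bullet>\<^bsub>?A\<lparr>carrier := N\<rparr>\<^esub> u) = f x \<bullet>\<^bsub>E\<^esub> u"
      by simp
  qed
  moreover have "injective_rmodule R E"
    using env by (simp add: injective_envelope_def)
  ultimately obtain g where g: "g \<in> rmod_hom R ?A E" and gf: "\<And>x. x \<in> N \<Longrightarrow> g x = f x"
    using N A.right_module_axioms unfolding injective_rmodule_def by blast
  have "g i = \<zero>\<^bsub>E\<^esub>" if i: "i \<in> I" for i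
  proof -
    have i_eq: "r \<otimes> \<zero> \<oplus> i = i"
      using r i Ic by simp
    then have "i \<in> N"
      using i unfolding N_def by (metis (mono_tags, lifting) mem_Collect_eq zero_closed)
    then have "g i = \<iota> (s \<otimes> \<zero>)"
      using gf f_eq[OF zero_closed i] i_eq by simp
    then show ?thesis
      using s \<iota>.hom_zero by simp
  qed
  then obtain h where h: "h \<in> rmod_hom R (quotient_rmodule ?A I) E"
    and hg: "\<And>x. x \<in> carrier R \<Longrightarrow> h (I +>\<^bsub>?A\<^esub> x) = g x"
    using A.rmod_hom_factors_through_quotient[of I E g] g I E.M.abelian_group_axioms
    by (auto simp: right_ideal_def)
  have r_eq: "r \<otimes> \<one> \<oplus> \<zero> = r"
    using r by simp
  then have "r \<in> N"
    using I_closed(2) unfolding N_def by (metis (mono_tags, lifting) mem_Collect_eq one_closed)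
  then have "g r = \<iota> s"
    using gf f_eq[OF one_closed I_closed(2)] r_eq s by simp
  moreover have "h (I +>\<^bsub>?A\<^esub> r) = \<zero>\<^bsub>E\<^esub>"
  proof -
    have "I +>\<^bsub>?A\<^esub> r \<in> a_rcosets\<^bsub>?A\<^esub> I"
      using A.M.a_rcosetsI[of I r] r I_closed(1) by simp
    then show ?thesis
      using tors h by (auto simp: cogenerated_torsion_def)
  qed
  ultimately have "\<iota> s = \<iota> \<zero>"
    using hg[OF r] \<iota>.hom_zero by simp
  then show False
    using inj s \<open>s \<noteq> \<zero>\<close> by (auto dest: inj_onD)
qed

text \<open>
  Let \<open>e\<close> be the value at the coset of \<open>r\<close> and suppose \<open>e \<noteq> 0\<close>. Essentiality, applied to
  \<open>e R\<close>, gives \<open>e a = \<iota> s \<noteq> 0\<close>. Density of \<open>I\<close> at \<open>r a\<close> and \<open>s\<close> gives \<open>t\<close> with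
  \<open>r a t \<in> I\<close> and \<open>s t \<noteq> 0\<close>; but \<open>\<iota> (s t) = e a t\<close> is the value at the coset of \<open>r a t\<close>,
  which is zero.
\<close>

lemma torsion_if_dense:
  fixes E :: "('a, 'e, 'n) rmodule_scheme"
  assumes env: "injective_envelope R (regular_rmodule R) E \<iota>"
    and dense: "dense_right_ideal I R"
  shows "cogenerated_torsion R E (quotient_rmodule (regular_rmodule R) I)"
  unfolding cogenerated_torsion_def
proof (intro conjI ballI)
  let ?A = "regular_rmodule R"
  let ?Q = "quotient_rmodule ?A I"
  interpret A: right_module R ?A by (rule right_module_regular)
  interpret E: right_module R E
    using env by (simp add: injective_envelope_def injective_rmodule_def)
  have I: "right_submodule R I ?A"
    using dense by (simp add: dense_right_ideal_def right_ideal_def)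
  show Q: "right_module R ?Q"
    by (rule A.right_module_quotient[OF I])
  interpret Q: right_module R ?Q by (rule Q)
  interpret I: abelian_subgroup I ?A
    by (rule A.submodule_abelian_subgroup[OF I])
  have \<iota>: "\<iota> \<in> rmod_hom R ?A E" and inj: "inj_on \<iota> (carrier R)"
    and ess: "\<And>N. \<lbrakk>right_submodule R N E; N \<inter> \<iota> ` carrier R = {\<zero>\<^bsub>E\<^esub>}\<rbrakk> \<Longrightarrow> N = {\<zero>\<^bsub>E\<^esub>}"
    using env by (simp_all add: injective_envelope_def essential_rsubmodule_def)
  interpret \<iota>: abelian_group_hom ?A E \<iota>
    by (rule rmod_hom_abelian_group_hom[OF A.M.abelian_group_axioms E.M.abelian_group_axioms \<iota>])
  fix f X assume f: "f \<in> rmod_hom R ?Q E" and X: "X \<in> carrier ?Q"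
  interpret f: abelian_group_hom ?Q E f
    by (rule rmod_hom_abelian_group_hom[OF Q.M.abelian_group_axioms E.M.abelian_group_axioms f])
  obtain r where r: "r \<in> carrier R" and X_eq: "X = I +>\<^bsub>?A\<^esub> r"
    using A.quotient_rmodule_carrierE[OF X] by auto
  have fX: "f X \<in> carrier E"
    by (rule rmod_hom_closed[OF f X])
  define C where "C = {f X \<bullet>\<^bsub>E\<^esub> a | a. a \<in> carrier R}"
  have C_I: "f X \<bullet>\<^bsub>E\<^esub> a \<in> C" if "a \<in> carrier R" for a
    using that by (auto simp: C_def)
  have C: "right_submodule R C E"
    unfolding C_def by (rule E.cyclic_submodule[OF fX])
  show "f X = \<zero>\<^bsub>E\<^esub>"
  proof (rule ccontr)
    assume nz: "f X \<noteq> \<zero>\<^bsub>E\<^esub>"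
    have "f X \<in> C"
      using C_I[OF one_closed] E.ract_one[OF fX] by simp
    with nz have "C \<inter> \<iota> ` carrier R \<noteq> {\<zero>\<^bsub>E\<^esub>}"
      using ess[OF C] by blast
    moreover have "\<zero>\<^bsub>E\<^esub> \<in> C"
      using C_I[OF zero_closed] E.ract_zero_right[OF fX] by simp
    moreover have "\<zero>\<^bsub>E\<^esub> \<in> \<iota> ` carrier R"
      using \<iota>.hom_zero by (metis imageI regular_rmodule_simps(2) zero_closed)
    ultimately obtain y where "y \<in> C" "y \<in> \<iota> ` carrier R" and y: "y \<noteq> \<zero>\<^bsub>E\<^esub>"
      by blast
    then obtain a s where a: "a \<in> carrier R" and s: "s \<in> carrier R"
      and as: "f X \<bullet>\<^bsub>E\<^esub> a = \<iota> s" and "\<iota> s \<noteq> \<zero>\<^bsub>E\<^esub>"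
      unfolding C_def by (elim CollectE imageE exE conjE) simp
    then have "s \<noteq> \<zero>"
      using \<iota>.hom_zero by (metis regular_rmodule_simps(2))
    then obtain t where t: "t \<in> carrier R" and st: "s \<otimes> t \<noteq> \<zero>" and rat: "(r \<otimes> a) \<otimes> t \<in> I"
      using dense r a s unfolding dense_right_ideal_def by blast
    have "\<iota> (s \<otimes> t) = f X \<bullet>\<^bsub>E\<^esub> (a \<otimes> t)"
      using rmod_hom_ract[OF \<iota>, of s t] s t a E.ract_mult[OF fX a t] as by simp
    also have "\<dots> = f (X \<bullet>\<^bsub>?Q\<^esub> (a \<otimes> t))"
      using rmod_hom_ract[OF f X, of "a \<otimes> t"] a t by simp
    also have "X \<bullet>\<^bsub>?Q\<^esub> (a \<otimes> t) = I +>\<^bsub>?A\<^esub> (r \<otimes> (a \<otimes> t))"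
      using A.quotient_ract_coset[OF I, of r "a \<otimes> t"] r a t unfolding X_eq by simp
    also have "\<dots> = \<zero>\<^bsub>?Q\<^esub>"
      using I.a_rcos_const rat r a t by (simp add: m_assoc)
    finally have "\<iota> (s \<otimes> t) = \<iota> \<zero>"
      using f.hom_zero \<iota>.hom_zero by simp
    then show False
      using inj st s t by (auto dest: inj_onD)
  qed
qed

theorem gabriel_filter_cogenerated_by_envelope:
  fixes E :: "('a, 'e, 'n) rmodule_scheme"
  assumes "injective_envelope R (regular_rmodule R) E \<iota>"
  shows "gabriel_filter R (cogenerated_torsion R E) = {I. dense_right_ideal I R}"
proof -
  have "right_ideal I R" if "dense_right_ideal I R" for I
    using that by (simp add: dense_right_ideal_def)
  then show ?thesis
    using dense_if_torsion[OF assms] torsion_if_dense[OF assms]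
    unfolding gabriel_filter_def by blast
qed


section \<open>Derivations and dense right ideals\<close>

text \<open>
  By the product rule, \<open>\<delta> (x y)\<close> lies in \<open>I\<close> as soon as both \<open>x\<close> and \<open>\<delta> x y\<close> do.
  With \<open>\<delta> x \<in> I\<close> this makes the set a right ideal; with \<open>x = r t\<close> it reduces
  density to two uses of the density of \<open>I\<close>, the second of which repairs \<open>\<delta> (r t)\<close>.
\<close>

lemma derivation_dense_preimage:
  assumes \<delta>: "ring_derivation R \<delta>" and dense: "dense_right_ideal I R"
  shows "dense_right_ideal {r \<in> I. \<delta> r \<in> I} R"
proof -
  have \<delta>_closed: "\<And>r. r \<in> carrier R \<Longrightarrow> \<delta> r \<in> carrier R"
    and \<delta>_add: "\<And>r s. \<lbrakk>r \<in> carrier R; s \<in> carrier R\<rbrakk> \<Longrightarrow> \<delta> (r \<oplus> s) = \<delta> r \<oplus> \<delta> s"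
    and \<delta>_mult: "\<And>r s. \<lbrakk>r \<in> carrier R; s \<in> carrier R\<rbrakk> \<Longrightarrow> \<delta> (r \<otimes> s) = \<delta> r \<otimes> s \<oplus> r \<otimes> \<delta> s"
    using \<delta> by (auto simp: ring_derivation_def)
  have I: "right_ideal I R"
    and denseE: "\<And>r s. \<lbrakk>r \<in> carrier R; s \<in> carrier R; s \<noteq> \<zero>\<rbrakk> \<Longrightarrow>
      \<exists>t\<in>carrier R. s \<otimes> t \<noteq> \<zero> \<and> r \<otimes> t \<in> I"
    using dense by (auto simp: dense_right_ideal_def)
  note I_closed = right_ideal_closed[OF I]
  have Ic: "x \<in> carrier R" if "x \<in> I" for x
    using that I_closed(1) by auto
  have \<delta>_zero: "\<delta> \<zero> = \<zero>"
    using \<delta>_add[of \<zero> \<zero>] \<delta>_closed[of \<zero>] by (simp add: add.l_cancel_one')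
  show ?thesis
    unfolding dense_right_ideal_def
  proof (intro conjI ballI impI)
    show "right_ideal {r \<in> I. \<delta> r \<in> I} R"
    proof (rule right_idealI)
      show "{r \<in> I. \<delta> r \<in> I} \<noteq> {}"
        using I_closed(2) \<delta>_zero by auto
    qed (auto simp: Ic I_closed \<delta>_add \<delta>_mult \<delta>_closed)
  next
    fix r s assume r: "r \<in> carrier R" and s: "s \<in> carrier R" "s \<noteq> \<zero>"
    obtain t where t: "t \<in> carrier R" "s \<otimes> t \<noteq> \<zero>" "r \<otimes> t \<in> I"
      using denseE[OF r s] by blast
    obtain u where u: "u \<in> carrier R" "(s \<otimes> t) \<otimes> u \<noteq> \<zero>" "\<delta> (r \<otimes> t) \<otimes> u \<in> I"
      using denseE[of "\<delta> (r \<otimes> t)" "s \<otimes> t"] r s t \<delta>_closed by auto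
    have "\<delta> ((r \<otimes> t) \<otimes> u) \<in> I"
      using r t u by (simp add: \<delta>_mult[of "r \<otimes> t"] I_closed \<delta>_closed)
    then have "s \<otimes> (t \<otimes> u) \<noteq> \<zero> \<and> r \<otimes> (t \<otimes> u) \<in> {r \<in> I. \<delta> r \<in> I}"
      using r s t u I_closed(5)[of "r \<otimes> t" u] by (simp add: m_assoc)
    then show "\<exists>v\<in>carrier R. s \<otimes> v \<noteq> \<zero> \<and> r \<otimes> v \<in> {r \<in> I. \<delta> r \<in> I}"
      using t u by blast
  qed
qed

end

theorem proposition9:
  fixes R :: "('a, 'm) ring_scheme"
    and E :: "('a, 'e, 'n) rmodule_scheme"
    and \<iota> :: "'a \<Rightarrow> 'e"
  assumes "ring R"
  shows "differential_filter R {I. dense_right_ideal I R} \<and>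
    (injective_envelope R (regular_rmodule R) E \<iota> \<longrightarrow>
       differential_filter R (gabriel_filter R (cogenerated_torsion R E)))"
proof -
  interpret R: ring R by fact
  have "differential_filter R {I. dense_right_ideal I R}"
    unfolding differential_filter_def
  proof (intro allI impI ballI)
    fix \<delta> I assume "ring_derivation R \<delta>" "I \<in> {I. dense_right_ideal I R}"
    then have "dense_right_ideal {r \<in> I. \<delta> r \<in> I} R"
      using R.derivation_dense_preimage by blast
    then show "\<exists>J\<in>{I. dense_right_ideal I R}. \<delta> ` J \<subseteq> I"
      by (intro bexI[of _ "{r \<in> I. \<delta> r \<in> I}"]) auto
  qed
  then show ?thesis
    using R.gabriel_filter_cogenerated_by_envelope[of E \<iota>] by simp
qed

end
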